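(* For every integer $n\geq 3$ and every positive integer $m$, $$sn(K_n\circ K_m)=\begin{cases}nm+n-m-1, & \text{if } m\leq n-2,\\ n(m-1)+1, & \text{if } m\geq n-1.\end{cases}$$
   Context: All graphs are finite, undirected, simple and connected. $\chi(G)$ is the chromatic number. $K_n$ is the complete graph on $n$ vertices. Sudoku number: let $\chi(G)=k$ and fix the set of $k$ colors $\{1,\dots,k\}$. For $S\subset V(G)$ let $C_0$ be a proper coloring of the induced subgraph $G[S]$ with colors from these $k$ colors (at most $k$ colors are used). $C_0$ is called extendable if it can be extended to a proper coloring of $G$ with these $k$ colors, and it is a Sudoku coloring of $G$ if this extension exists and is unique. The Sudoku number $sn(G)$ is the smallest $|S|$ such that $G[S]$ admits a Sudoku coloring. Corona product: $G\circ H$ is obtained from one copy of $G$ and $|V(G)|$ disjoint copies of $H$ by joining the $i$-th vertex of $G$ to every vertex of the $i$-th copy of $H$. *)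

theory Defs
  imports "Graph_Theory.Graph_Theory" "HOL-Library.FuncSet"
begin

(* Simple graphs are symmetric loop-free digraphs, as in the library locales graph and pair_graph:
   an undirected edge is a pair of opposite arcs. *)

(* Colorings are extensional (undefined outside the vertex set), so that counting functions
   is counting colorings; in particular EX! below means exactly one coloring. *)
definition proper_coloring :: "('a, 'b) pre_digraph \<Rightarrow> nat \<Rightarrow> ('a \<Rightarrow> nat) \<Rightarrow> bool" where
  "proper_coloring G k c \<longleftrightarrow>
     c \<in> verts G \<rightarrow>\<^sub>E {1..k} \<and> (\<forall>u v. u \<rightarrow>\<^bsub>G\<^esub> v \<longrightarrow> c u \<noteq> c v)"

definition chromatic_number :: "('a, 'b) pre_digraph \<Rightarrow> nat" where
  "chromatic_number G = (LEAST k. \<exists>c. proper_coloring G k c)"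

(* The palette always has chromatic_number G colors, even if the coloring of the induced
   subgraph on S uses fewer. *)
definition extension_of ::
    "('a, 'b) pre_digraph \<Rightarrow> 'a set \<Rightarrow> ('a \<Rightarrow> nat) \<Rightarrow> ('a \<Rightarrow> nat) \<Rightarrow> bool" where
  "extension_of G S C\<^sub>0 c \<longleftrightarrow>
     proper_coloring G (chromatic_number G) c \<and> (\<forall>v\<in>S. c v = C\<^sub>0 v)"

definition sudoku_coloring :: "('a, 'b) pre_digraph \<Rightarrow> 'a set \<Rightarrow> ('a \<Rightarrow> nat) \<Rightarrow> bool" where
  "sudoku_coloring G S C\<^sub>0 \<longleftrightarrow>
     S \<subseteq> verts G \<and> proper_coloring (G \<restriction> S) (chromatic_number G) C\<^sub>0 \<and>
     (\<exists>!c. extension_of G S C\<^sub>0 c)"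

definition sudoku_number :: "('a, 'b) pre_digraph \<Rightarrow> nat" where
  "sudoku_number G = (LEAST s. \<exists>S C\<^sub>0. sudoku_coloring G S C\<^sub>0 \<and> card S = s)"

(* Inl g is the vertex g of G; Inr (g, h) is the vertex h of the copy of H attached to g. *)
definition corona :: "'a pair_pre_digraph \<Rightarrow> 'b pair_pre_digraph \<Rightarrow> ('a + 'a \<times> 'b) pair_pre_digraph" where
  "corona G H = \<lparr>
     pverts = Inl ` pverts G \<union> Inr ` (pverts G \<times> pverts H),
     parcs = {(Inl g, Inl g') | g g'. (g, g') \<in> parcs G}
       \<union> {(Inr (g, h), Inr (g, h')) | g h h'. g \<in> pverts G \<and> (h, h') \<in> parcs H}
       \<union> {(Inl g, Inr (g, h)) | g h. g \<in> pverts G \<and> h \<in> pverts H}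
       \<union> {(Inr (g, h), Inl g) | g h. g \<in> pverts G \<and> h \<in> pverts H} \<rparr>"

lemma pair_graph_corona:
  assumes "pair_graph G" "pair_graph H"
  shows "pair_graph (corona G H)"
proof -
  interpret G: pair_graph G by fact
  interpret H: pair_graph H by fact
  have sG: "(g', g) \<in> parcs G" if "(g, g') \<in> parcs G" for g g'
    using that G.pair_sym_arcs by (auto simp: symmetric_def dest: symD)
  have sH: "(h', h) \<in> parcs H" if "(h, h') \<in> parcs H" for h h'
    using that H.pair_sym_arcs by (auto simp: symmetric_def dest: symD)
  have fin: "finite (pverts (corona G H))"
    by (simp add: corona_def G.pair_finite_verts H.pair_finite_verts)
  have sub: "parcs (corona G H) \<subseteq> pverts (corona G H) \<times> pverts (corona G H)"
    by (auto simp: corona_def dest: G.wellformed' H.wellformed')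
  have finA: "finite (parcs (corona G H))"
    using finite_subset[OF sub] fin by blast
  have nl: "fst e \<noteq> snd e" if "e \<in> parcs (corona G H)" for e
    using that G.pair_no_loops H.pair_no_loops by (fastforce simp: corona_def)
  have sy: "symmetric (with_proj (corona G H))"
    unfolding symmetric_def
    by (rule symI) (auto simp: corona_def dest: sG sH)
  show ?thesis
    by unfold_locales (use fin finA nl sy sub in auto)
qed

end

theory Submission
  imports Defs
begin

text \<open>
  The palette has \<open>k = max n (m + 1)\<close> colors. Suppose every vertex \<open>g\<close> of a clique with an injective
  coloring \<open>c\<close> is offered a second color \<open>d g \<noteq> c g\<close>. Then some vertices can switch to their second
  color so that the coloring remains injective: either some \<open>d g\<close> is unused, or following
  \<open>g \<mapsto> c\<^sup>-\<^sup>1 (d g)\<close> leads to a cycle, along which the colors are rotated.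

  If \<open>m + 1 < n\<close>, a copy of \<open>K\<^sub>m\<close> together with its center misses a color, so a Sudoku coloring
  prescribes all copies; and if \<open>m + 2\<close> centers were free, each of them would be offered
  a second color of a free center. If \<open>n \<le> m + 1\<close>, at most one vertex of each copy is free, as two
  of them could exchange their colors; and if every center and one vertex of every copy were free, the
  color of the latter would be the second color of the center.

  In both cases the bound is attained with the coloring giving color \<open>i\<close> to the \<open>i\<close>-th
  center and the first \<open>m\<close> colors other than \<open>i\<close> to its copy.
\<close>

section \<open>A second system of distinct colors\<close>

text \<open>Iterated images of \<open>U\<close> under \<open>f\<close> shrink; on a finite set they
  stabilize, and the stable set is mapped onto itself.\<close>

lemma ex_invariant_subset:
  assumes "finite U" "U \<noteq> {}" "f ` U \<subseteq> U"
  shows "\<exists>R\<subseteq>U. R \<noteq> {} \<and> f ` R = R"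
  using assms
proof (induction U rule: finite_psubset_induct)
  case (psubset U)
  show ?case
  proof (cases "f ` U = U")
    case False
    with psubset have "\<exists>R\<subseteq>f ` U. R \<noteq> {} \<and> f ` R = R"
      by (intro psubset.IH) auto
    with psubset.prems(2) show ?thesis by (meson order_trans)
  next
    case True
    with psubset.prems(1) show ?thesis by (intro exI[of _ U]) simp
  qed
qed

text \<open>Serves both lower bounds: second colors for free centers yield another injective
  coloring of the centers, against uniqueness of the extension.\<close>

lemma ex_other_inj_on:
  assumes fin: "finite V" and ne: "V \<noteq> {}" and inj: "inj_on c V"
    and d: "\<And>g. g \<in> V \<Longrightarrow> d g \<noteq> c g"
  obtains e where "inj_on e V" "\<And>g. g \<in> V \<Longrightarrow> e g \<in> {c g, d g}" "\<exists>g\<in>V. e g \<noteq> c g"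
proof -
  \<comment> \<open>\<open>R\<close> collects the vertices that switch. The last two conditions
    exclude collisions among the new colors and between new and kept ones; nonemptiness makes the
    change real.\<close>
  obtain R where R: "R \<subseteq> V" "R \<noteq> {}" "inj_on d R" "d ` R \<inter> c ` (V - R) = {}"
  proof (cases "d ` V \<subseteq> c ` V")
    case True
    \<comment> \<open>\<open>f g\<close> is the vertex whose current color is \<open>d g\<close>, so
      switching on a set that \<open>f\<close> permutes merely moves the current colors
      around.\<close>
    define f where "f = inv_into V c \<circ> d"
    have f: "f g \<in> V" "c (f g) = d g" if "g \<in> V" for g
      using that True by (auto simp: f_def intro!: inv_into_into f_inv_into_f)
    obtain R where R: "R \<subseteq> V" "R \<noteq> {}" "f ` R = R"
      using ex_invariant_subset[OF fin ne, of f] f by blast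
    have "finite R" using R fin finite_subset by blast
    \<comment> \<open>A map of a finite set onto itself is injective, and \<open>f\<close> factors
      through \<open>d\<close>.\<close>
    then have "inj_on f R" using R by (simp add: eq_card_imp_inj_on)
    then have "inj_on d R"
      unfolding f_def by (rule inj_on_imageI2)
    moreover have "d ` R \<inter> c ` (V - R) = {}"
    proof -
      have "d ` R = c ` f ` R"
        unfolding image_image using R(1) f by (intro image_cong) auto
      moreover have "c ` R \<inter> c ` (V - R) = c ` (R \<inter> (V - R))"
        using inj R(1) by (intro inj_on_image_Int[symmetric]) auto
      ultimately show ?thesis by (simp add: R(3))
    qed
    ultimately show ?thesis using that R by blast
  next
    case False
    then obtain g where "g \<in> V" "d g \<notin> c ` V" by blast
    then show ?thesis by (intro that[of "{g}"]) auto
  qed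
  show ?thesis
  proof (rule that[of "\<lambda>g. if g \<in> R then d g else c g"])
    show "inj_on (\<lambda>g. if g \<in> R then d g else c g) V"
    proof (rule inj_onI)
      fix x y
      assume "x \<in> V" "y \<in> V" "(if x \<in> R then d x else c x) = (if y \<in> R then d y else c y)"
      moreover have "d u \<noteq> c v" if "u \<in> R" "v \<in> V" "v \<notin> R" for u v
        using that R(4) by blast
      ultimately show "x = y"
        using R(3) inj by (metis inj_onD)
    qed
  qed (use R d in \<open>auto simp: subset_iff\<close>)
qed

section \<open>Determining sets\<close>

text \<open>Replaces the partial coloring \<open>C\<^sub>0\<close> by a total coloring
  \<open>c\<close> from which the prescribed values are read off, so that their properness on the
  induced subgraph is automatic. Such an \<open>S\<close> is known as a defining set of
  \<open>c\<close>.\<close>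

definition determines :: "('a, 'b) pre_digraph \<Rightarrow> 'a set \<Rightarrow> ('a \<Rightarrow> nat) \<Rightarrow> bool" where
  "determines G S c \<longleftrightarrow>
     S \<subseteq> verts G \<and> proper_coloring G (chromatic_number G) c \<and>
     (\<forall>c'. proper_coloring G (chromatic_number G) c' \<and> (\<forall>v\<in>S. c' v = c v) \<longrightarrow> c' = c)"

lemma proper_coloring_induce_subgraph:
  assumes "proper_coloring G k c" "S \<subseteq> verts G"
  shows "proper_coloring (G \<restriction> S) k (restrict c S)"
  unfolding proper_coloring_def
proof (intro conjI allI impI)
  show "restrict c S \<in> verts (G \<restriction> S) \<rightarrow>\<^sub>E {1..k}"
    using assms by (auto simp: proper_coloring_def PiE_iff)
next
  fix u v assume uv: "u \<rightarrow>\<^bsub>G \<restriction> S\<^esub> v"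
  then have "u \<in> S" "v \<in> S" "u \<rightarrow>\<^bsub>G\<^esub> v"
    by (auto simp: arcs_ends_def arc_to_ends_def induce_subgraph_def)
  then show "restrict c S u \<noteq> restrict c S v"
    using assms by (auto simp: proper_coloring_def)
qed

text \<open>The unique extension of \<open>C\<^sub>0\<close> serves as \<open>c\<close>; conversely,
  \<open>c\<close> restricted to \<open>S\<close> serves as \<open>C\<^sub>0\<close>.\<close>

lemma ex_sudoku_coloring_iff: "(\<exists>C\<^sub>0. sudoku_coloring G S C\<^sub>0) \<longleftrightarrow> (\<exists>c. determines G S c)"
proof
  assume "\<exists>C\<^sub>0. sudoku_coloring G S C\<^sub>0"
  then obtain C\<^sub>0 where "S \<subseteq> verts G" and ex1: "\<exists>!c. extension_of G S C\<^sub>0 c"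
    unfolding sudoku_coloring_def by blast
  obtain c where c: "extension_of G S C\<^sub>0 c" using ex1 by blast
  have "c' = c" if "proper_coloring G (chromatic_number G) c'" "\<forall>v\<in>S. c' v = c v" for c'
  proof -
    have "extension_of G S C\<^sub>0 c'" using that c by (simp add: extension_of_def)
    with ex1 c show ?thesis by blast
  qed
  with c \<open>S \<subseteq> verts G\<close> have "determines G S c"
    unfolding determines_def extension_of_def by blast
  then show "\<exists>c. determines G S c" by blast
next
  assume "\<exists>c. determines G S c"
  then obtain c where c: "determines G S c" by blast
  have "sudoku_coloring G S (restrict c S)"
    unfolding sudoku_coloring_def
  proof (intro conjI ex1I[of _ c])
    show "proper_coloring (G \<restriction> S) (chromatic_number G) (restrict c S)"
      using c by (intro proper_coloring_induce_subgraph) (simp_all add: determines_def)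
    show "extension_of G S (restrict c S) c"
      using c by (simp add: determines_def extension_of_def)
    show "c' = c" if "extension_of G S (restrict c S) c'" for c'
      using c that by (simp add: determines_def extension_of_def)
    show "S \<subseteq> verts G"
      using c by (simp add: determines_def)
  qed
  then show "\<exists>C\<^sub>0. sudoku_coloring G S C\<^sub>0" by blast
qed

lemma sudoku_number_eqI:
  assumes "determines G S c" "card S = s"
    and "\<And>S c. determines G S c \<Longrightarrow> s \<le> card S"
  shows "sudoku_number G = s"
  unfolding sudoku_number_def
proof (rule Least_equality)
  show "\<exists>S C\<^sub>0. sudoku_coloring G S C\<^sub>0 \<and> card S = s"
    using assms(1,2) ex_sudoku_coloring_iff[of G S] by blast
next
  fix t assume "\<exists>S C\<^sub>0. sudoku_coloring G S C\<^sub>0 \<and> card S = t"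
  then obtain S C\<^sub>0 where S: "sudoku_coloring G S C\<^sub>0" "card S = t" by blast
  then obtain c where "determines G S c" using ex_sudoku_coloring_iff[of G S] by blast
  with S assms(3) show "s \<le> t" by blast
qed

section \<open>Coronas of complete graphs\<close>

text \<open>The enumerations \<open>p\<close> and \<open>q\<close> order the centers and the
  vertices of a copy, as the explicit extremal coloring requires. They count from 0, whereas colors
  count from 1.\<close>

locale complete_corona =
  fixes G :: "'a pair_pre_digraph" and H :: "'b pair_pre_digraph" and n m :: nat
    and p :: "'a \<Rightarrow> nat" and q :: "'b \<Rightarrow> nat"
  assumes KG: "K\<^bsub>n\<^esub> (with_proj G)" and KH: "K\<^bsub>m\<^esub> (with_proj H)"
    and p: "bij_betw p (pverts G) {..<n}" and q: "bij_betw q (pverts H) {..<m}"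
    and n_pos: "n \<ge> 1" and m_pos: "m \<ge> 1"
begin

abbreviation "V \<equiv> pverts G"
abbreviation "W \<equiv> pverts H"
abbreviation "\<Gamma> \<equiv> with_proj (corona G H)"

section \<open>Size, adjacency and proper colorings of the corona\<close>

lemma finite_V [simp]: "finite V" and finite_W [simp]: "finite W"
  using p q bij_betw_finite by blast+

lemma card_V: "card V = n" and card_W: "card W = m"
  using p q bij_betw_same_card by fastforce+

lemma V_nonempty: "V \<noteq> {}"
  using card_V n_pos by auto

lemma verts_corona:
  "verts \<Gamma> = Inl ` V \<union> Inr ` (V \<times> W)"
  "pverts (corona G H) = Inl ` V \<union> Inr ` (V \<times> W)"
  by (simp_all add: corona_def)

lemma finite_verts_corona: "finite (pverts (corona G H))"
  by (simp add: verts_corona)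

lemma card_verts_corona: "card (pverts (corona G H)) = n + n * m"
proof -
  have "card (Inl ` V \<union> Inr ` (V \<times> W)) =
      card (Inl ` V :: ('a + 'a \<times> 'b) set) + card (Inr ` (V \<times> W) :: ('a + 'a \<times> 'b) set)"
    by (rule card_Un_disjoint) auto
  then show ?thesis
    by (simp add: verts_corona card_image card_cartesian_product card_V card_W)
qed

lemma adj_corona:
  "u \<rightarrow>\<^bsub>\<Gamma>\<^esub> v \<longleftrightarrow>
    (\<exists>g\<in>V. \<exists>g'\<in>V. g \<noteq> g' \<and> u = Inl g \<and> v = Inl g') \<or>
    (\<exists>g\<in>V. \<exists>h\<in>W. \<exists>h'\<in>W. h \<noteq> h' \<and> u = Inr (g, h) \<and> v = Inr (g, h')) \<or>
    (\<exists>g\<in>V. \<exists>h\<in>W. u = Inl g \<and> v = Inr (g, h) \<or> u = Inr (g, h) \<and> v = Inl g)"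
proof -
  have "parcs G = {(u, v). u \<in> V \<and> v \<in> V \<and> u \<noteq> v}"
    "parcs H = {(u, v). u \<in> W \<and> v \<in> W \<and> u \<noteq> v}"
    using KG KH by (auto simp: complete_digraph_def)
  then show ?thesis
    by (auto simp: corona_def)
qed

text \<open>On a clique, properness is injectivity. Besides membership in the palette, each later
  recoloring thus needs three checks: the centers, each copy, and each center against its
  copy.\<close>

lemma proper_coloring_corona_iff:
  "proper_coloring \<Gamma> k c \<longleftrightarrow>
    c \<in> verts \<Gamma> \<rightarrow>\<^sub>E {1..k} \<and> inj_on (\<lambda>g. c (Inl g)) V \<and>
    (\<forall>g\<in>V. inj_on (\<lambda>h. c (Inr (g, h))) W \<and> (\<forall>h\<in>W. c (Inr (g, h)) \<noteq> c (Inl g)))"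
  (is "?L \<longleftrightarrow> ?R")
proof
  assume ?L
  then have fn: "c \<in> verts \<Gamma> \<rightarrow>\<^sub>E {1..k}" and ne: "\<And>u v. u \<rightarrow>\<^bsub>\<Gamma>\<^esub> v \<Longrightarrow> c u \<noteq> c v"
    unfolding proper_coloring_def by blast+
  show ?R
  proof (intro conjI ballI inj_onI)
    fix g g' assume "g \<in> V" "g' \<in> V" "c (Inl g) = c (Inl g')"
    then show "g = g'" using ne[of "Inl g" "Inl g'"] unfolding adj_corona by blast
  next
    fix g h h' assume "g \<in> V" "h \<in> W" "h' \<in> W" "c (Inr (g, h)) = c (Inr (g, h'))"
    then show "h = h'" using ne[of "Inr (g, h)" "Inr (g, h')"] unfolding adj_corona by blast
  next
    fix g h assume "g \<in> V" "h \<in> W"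
    then show "c (Inr (g, h)) \<noteq> c (Inl g)"
      using ne[of "Inr (g, h)" "Inl g"] unfolding adj_corona by blast
  qed (rule fn)
next
  assume R: ?R
  show ?L
    unfolding proper_coloring_def adj_corona
  proof (intro conjI allI impI)
    fix u v
    assume "(\<exists>g\<in>V. \<exists>g'\<in>V. g \<noteq> g' \<and> u = Inl g \<and> v = Inl g') \<or>
      (\<exists>g\<in>V. \<exists>h\<in>W. \<exists>h'\<in>W. h \<noteq> h' \<and> u = Inr (g, h) \<and> v = Inr (g, h')) \<or>
      (\<exists>g\<in>V. \<exists>h\<in>W. u = Inl g \<and> v = Inr (g, h) \<or> u = Inr (g, h) \<and> v = Inl g)"
    then show "c u \<noteq> c v"
      using R by (elim disjE bexE conjE) (auto simp: inj_on_def; metis)+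
  qed (use R in blast)
qed

section \<open>The standard coloring and the chromatic number\<close>

text \<open>The inner \<open>if\<close> makes the copy at \<open>g\<close> jump over the color
  \<open>Suc (p g)\<close> of its center. The bounded abstraction is there because colorings are
  extensional.\<close>

definition standard :: "'a + 'a \<times> 'b \<Rightarrow> nat" where
  "standard = (\<lambda>v\<in>verts \<Gamma>. case v of
     Inl g \<Rightarrow> Suc (p g) | Inr (g, h) \<Rightarrow> Suc (if q h < p g then q h else Suc (q h)))"

lemma standard_simps [simp]:
  "g \<in> V \<Longrightarrow> standard (Inl g) = Suc (p g)"
  "g \<in> V \<Longrightarrow> h \<in> W \<Longrightarrow> standard (Inr (g, h)) = Suc (if q h < p g then q h else Suc (q h))"
  by (auto simp: standard_def verts_corona)

lemma p_less: "g \<in> V \<Longrightarrow> p g < n" and q_less: "h \<in> W \<Longrightarrow> q h < m"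
  using p q by (auto simp: bij_betw_def)

lemma proper_coloring_standard: "proper_coloring \<Gamma> (max n (m + 1)) standard"
  unfolding proper_coloring_corona_iff
proof (intro conjI ballI)
  show "standard \<in> verts \<Gamma> \<rightarrow>\<^sub>E {1..max n (m + 1)}"
  proof (rule PiE_I)
    fix v assume "v \<in> verts \<Gamma>"
    then show "standard v \<in> {1..max n (m + 1)}"
      using p_less q_less unfolding verts_corona by (fastforce simp: less_eq_Suc_le le_max_iff_disj)
  qed (simp add: standard_def)
  show "inj_on (\<lambda>g. standard (Inl g)) V"
    using p by (auto simp: inj_on_def bij_betw_def)
  fix g assume "g \<in> V"
  then show "inj_on (\<lambda>h. standard (Inr (g, h))) W"
    using q by (fastforce simp: inj_on_def bij_betw_def split: if_splits)
  fix h assume "h \<in> W"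
  with \<open>g \<in> V\<close> show "standard (Inr (g, h)) \<noteq> standard (Inl g)" by simp
qed

text \<open>The centers form a clique of size \<open>n\<close>, and each center with its copy forms
  one of size \<open>m + 1\<close>; the standard coloring attains the larger size.\<close>

lemma chromatic_number_corona: "chromatic_number \<Gamma> = max n (m + 1)"
  unfolding chromatic_number_def
proof (rule Least_equality)
  show "\<exists>c. proper_coloring \<Gamma> (max n (m + 1)) c"
    using proper_coloring_standard by blast
next
  fix k assume "\<exists>c. proper_coloring \<Gamma> k c"
  then obtain c where c: "proper_coloring \<Gamma> k c" by blast
  then have range: "c v \<in> {1..k}" if "v \<in> verts \<Gamma>" for v
    using that by (auto simp: proper_coloring_def)
  have "n \<le> card {1..k}"
    unfolding card_V[symmetric]
  proof (rule card_inj_on_le)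
    show "inj_on (\<lambda>g. c (Inl g)) V" using c by (simp add: proper_coloring_corona_iff)
  qed (use range verts_corona in auto)
  moreover obtain g where g: "g \<in> V" using V_nonempty by blast
  have "Suc m \<le> card {1..k}"
  proof -
    have "inj_on (\<lambda>h. c (Inr (g, h))) W" "c (Inl g) \<notin> (\<lambda>h. c (Inr (g, h))) ` W"
      using c g by (force simp: proper_coloring_corona_iff)+
    then have "Suc m = card (insert (c (Inl g)) ((\<lambda>h. c (Inr (g, h))) ` W))"
      by (simp add: card_image card_W)
    also have "\<dots> \<le> card {1..k}"
      using range g by (intro card_mono) (auto simp: verts_corona)
    finally show ?thesis .
  qed
  ultimately show "max n (m + 1) \<le> k" by simp
qed

section \<open>Upper bounds: prescribed sets that force the standard coloring\<close>

text \<open>Under \<open>p g \<le> m\<close>, a center and its copy together show exactly the colors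
  up to \<open>m + 1\<close>. Hence any wrong color in this range can be traced to a vertex of the
  copy.\<close>

lemma standard_surj:
  assumes "g \<in> V" "p g \<le> m" "x \<in> {1..m + 1}" "x \<noteq> Suc (p g)"
  obtains h where "h \<in> W" "standard (Inr (g, h)) = x"
proof -
  \<comment> \<open>Inverse of the map from positions to colors: a color below that of the center is
    its position plus 1, a color above it is its position plus 2.\<close>
  define j where "j = (if x \<le> p g then x - 1 else x - 2)"
  have "j < m" using assms by (auto simp: j_def)
  then obtain h where "h \<in> W" "q h = j"
    using q by (metis bij_betw_def imageE lessThan_iff)
  with assms have "standard (Inr (g, h)) = x"
    by (auto simp: j_def)
  with \<open>h \<in> W\<close> show ?thesis using that by blast
qed

lemma determines_standardI:
  assumes "S \<subseteq> verts \<Gamma>"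
    and "\<And>c v. \<lbrakk>proper_coloring \<Gamma> (max n (m + 1)) c; \<forall>v\<in>S. c v = standard v; v \<in> verts \<Gamma>; v \<notin> S\<rbrakk>
      \<Longrightarrow> c v = standard v"
  shows "determines \<Gamma> S standard"
  unfolding determines_def chromatic_number_corona
proof (intro conjI allI impI)
  fix c assume c: "proper_coloring \<Gamma> (max n (m + 1)) c \<and> (\<forall>v\<in>S. c v = standard v)"
  then have "c \<in> extensional (verts \<Gamma>)" by (auto simp: proper_coloring_def PiE_def)
  moreover have "standard \<in> extensional (verts \<Gamma>)" by (simp add: standard_def)
  ultimately show "c = standard"
    by (rule extensionalityI) (use c assms(2) in metis)
qed (use assms(1) proper_coloring_standard in auto)

text \<open>Exactly the centers with \<open>p g \<le> m\<close> are free. Such a center sees all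
  other colors up to \<open>m + 1\<close> in its copy and all larger colors at the prescribed
  centers.\<close>

lemma ex_determines_small:
  assumes "m + 1 < n"
  shows "\<exists>S. determines \<Gamma> S standard \<and> card S = n * m + n - m - 1"
proof -
  define D where "D = {g \<in> V. p g \<le> m}"
  define S where "S = verts \<Gamma> - Inl ` D"
  have "p ` D = p ` V \<inter> {..m}" by (auto simp: D_def)
  also have "\<dots> = {..m}" using p assms by (auto simp: bij_betw_def)
  finally have "p ` D = {..m}" .
  moreover have "inj_on p D"
    using p by (auto simp: D_def bij_betw_def inj_on_def)
  ultimately have "card D = m + 1"
    by (metis card_image card_atMost Suc_eq_plus1)
  then have "card (Inl ` D :: ('a + 'a \<times> 'b) set) = m + 1"
    by (simp add: card_image)
  moreover have "Inl ` D \<subseteq> verts \<Gamma>"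
    by (auto simp: D_def verts_corona)
  ultimately have "card S = n * m + n - m - 1"
    unfolding S_def using finite_verts_corona
    by (subst card_Diff_subset) (auto simp: card_verts_corona intro: finite_subset)
  moreover have "determines \<Gamma> S standard"
  proof (rule determines_standardI)
    fix c v
    assume c: "proper_coloring \<Gamma> (max n (m + 1)) c" and S: "\<forall>v\<in>S. c v = standard v"
      and "v \<in> verts \<Gamma>" "v \<notin> S"
    then obtain g where g: "g \<in> V" "p g \<le> m" "v = Inl g"
      by (auto simp: S_def D_def)
    define x where "x = c (Inl g)"
    have x: "x \<in> {1..n}"
      using c g assms by (auto simp: proper_coloring_def verts_corona x_def PiE_iff)
    have "x = Suc (p g)"
    proof (rule ccontr)
      assume ne: "x \<noteq> Suc (p g)"
      show False
      proof (cases "x \<le> m + 1")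
        case True
        then obtain h where h: "h \<in> W" "standard (Inr (g, h)) = x"
          using standard_surj[of g x] g x ne by auto
        then have "c (Inr (g, h)) = x"
          using S g by (simp add: S_def verts_corona image_iff)
        then show False
          using c g h by (auto simp: proper_coloring_corona_iff x_def)
      next
        case False
        \<comment> \<open>In the standard coloring, \<open>x\<close> belongs to the center at
          position \<open>x - 1\<close>. This position exceeds \<open>m\<close>, so that center lies
          in \<open>S\<close>.\<close>
        with x have "x - 1 \<in> p ` V" using p by (auto simp: bij_betw_def)
        then obtain g' where g': "g' \<in> V" "p g' = x - 1" by fastforce
        with False have "c (Inl g') = x"
          using S by (auto simp: S_def verts_corona D_def image_iff)
        then have "g' = g"
          using c g g' by (auto simp: proper_coloring_corona_iff x_def dest: inj_onD)
        with g g' False show False by simp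
      qed
    qed
    then show "c v = standard v" using g by (simp add: x_def)
  qed (auto simp: S_def)
  ultimately show ?thesis by blast
qed

text \<open>Free are all centers but \<open>g\<^sub>0\<close> and one vertex \<open>r g\<close> of
  each copy. For \<open>p g > 0\<close>, the standard color of \<open>r g\<close> is that of the
  preceding center, so the colors of the centers are forced one after another along
  \<open>p\<close>.\<close>

lemma ex_determines_large:
  assumes "n \<le> m + 1"
  shows "\<exists>S. determines \<Gamma> S standard \<and> card S = n * (m - 1) + 1"
proof -
  obtain g\<^sub>0 where g\<^sub>0: "g\<^sub>0 \<in> V" "p g\<^sub>0 = 0"
    using p n_pos by (metis bij_betw_def imageE lessThan_iff less_eq_Suc_le One_nat_def)
  \<comment> \<open>For \<open>p g = 0\<close> truncated subtraction picks the first vertex of the copy.\<close>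
  define r where "r g = inv_into W q (p g - 1)" for g
  have r: "r g \<in> W" "q (r g) = p g - 1" if "g \<in> V" for g
  proof -
    have "p g - 1 \<in> q ` W"
      using q p_less[OF that] assms m_pos by (auto simp: bij_betw_def)
    then show "r g \<in> W" "q (r g) = p g - 1"
      by (simp_all add: r_def inv_into_into f_inv_into_f)
  qed
  define S where "S = verts \<Gamma> - (Inl ` (V - {g\<^sub>0}) \<union> (\<lambda>g. Inr (g, r g)) ` V)"
  have "card (Inl ` (V - {g\<^sub>0}) \<union> (\<lambda>g. Inr (g, r g)) ` V)
      = card (Inl ` (V - {g\<^sub>0}) :: ('a + 'a \<times> 'b) set) + card ((\<lambda>g. Inr (g, r g)) ` V :: ('a + 'a \<times> 'b) set)"
    by (rule card_Un_disjoint) auto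
  also have "\<dots> = (n - 1) + n"
    using g\<^sub>0 by (simp add: card_image card_V inj_on_def)
  finally have "card (Inl ` (V - {g\<^sub>0}) \<union> (\<lambda>g. Inr (g, r g) :: 'a + 'a \<times> 'b) ` V) = n - 1 + n" .
  moreover have "Inl ` (V - {g\<^sub>0}) \<union> (\<lambda>g. Inr (g, r g)) ` V \<subseteq> verts \<Gamma>"
    using r by (auto simp: verts_corona)
  ultimately have "card S = n + n * m - (n - 1 + n)"
    unfolding S_def by (subst card_Diff_subset) (auto simp: card_verts_corona)
  also have "\<dots> = n * (m - 1) + 1"
    using n_pos m_pos by (cases m) auto
  finally have "card S = n * (m - 1) + 1" .
  moreover have "determines \<Gamma> S standard"
  proof (rule determines_standardI)
    fix c v
    assume c: "proper_coloring \<Gamma> (max n (m + 1)) c" and S: "\<forall>v\<in>S. c v = standard v"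
      and v: "v \<in> verts \<Gamma>" "v \<notin> S"
    have copy: "c (Inr (g, h)) = standard (Inr (g, h))" if "g \<in> V" "h \<in> W" "h \<noteq> r g" for g h
    proof -
      have "Inr (g, h) \<in> S" using that by (auto simp: S_def verts_corona)
      then show ?thesis using S by blast
    qed
    have range: "c v \<in> {1..m + 1}" if "v \<in> verts \<Gamma>" for v
      using c that assms by (auto simp: proper_coloring_def PiE_iff max_def split: if_splits)
    \<comment> \<open>The prescribed part of the copy leaves to the center only
      \<open>Suc (p g)\<close> and the standard color \<open>p g\<close> of \<open>r g\<close>; the
      latter is taken by the preceding center.\<close>
    have center: "c (Inl g) = Suc (p g)" if "g \<in> V" for g
      using that
    proof (induction "p g" arbitrary: g)
      case 0
      then have "g = g\<^sub>0" using inj_onD[OF bij_betw_imp_inj_on[OF p], of g g\<^sub>0] g\<^sub>0 by simp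
      moreover have "Inl g\<^sub>0 \<in> S" using g\<^sub>0 by (auto simp: S_def verts_corona)
      ultimately show ?case using S g\<^sub>0 by simp
    next
      case (Suc i)
      then have "i \<in> p ` V" using p p_less[of g] by (auto simp: bij_betw_def)
      then obtain g' where g': "g' \<in> V" "p g' = i" by blast
      then have prev: "c (Inl g') = Suc i" using Suc by blast
      show ?case
      proof (rule ccontr)
        assume ne: "c (Inl g) \<noteq> Suc (p g)"
        obtain h where h: "h \<in> W" "standard (Inr (g, h)) = c (Inl g)"
          using standard_surj[OF \<open>g \<in> V\<close> _ _ ne] range[of "Inl g"] \<open>g \<in> V\<close> p_less[of g] assms
          by (auto simp: verts_corona)
        show False
        proof (cases "h = r g")
          case True
          then have "c (Inl g) = Suc i"
            using h r[OF \<open>g \<in> V\<close>] Suc.hyps(2) \<open>g \<in> V\<close> by simp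
          with prev have "c (Inl g) = c (Inl g')" by simp
          then have "g = g'"
            using c g' \<open>g \<in> V\<close> by (auto simp: proper_coloring_corona_iff dest: inj_onD)
          with g' Suc.hyps(2) show False by simp
        next
          case False
          with h copy \<open>g \<in> V\<close> have "c (Inr (g, h)) = c (Inl g)" by simp
          with c h \<open>g \<in> V\<close> show False by (auto simp: proper_coloring_corona_iff)
        qed
      qed
    qed
    from v consider g where "g \<in> V" "v = Inl g" | g where "g \<in> V" "v = Inr (g, r g)"
      by (auto simp: S_def)
    then show "c v = standard v"
    proof cases
      case 1
      then show ?thesis using center by simp
    next
      case 2
      have rg: "r g \<in> W" using r 2 by blast
      \<comment> \<open>Once its center is settled, the clique around \<open>r g\<close> shows all
        of the \<open>m + 1\<close> colors but one.\<close>
      have "c v \<noteq> Suc (p g)"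
        using c 2 rg center[of g] by (auto simp: proper_coloring_corona_iff)
      then obtain h where h: "h \<in> W" "standard (Inr (g, h)) = c v"
        using standard_surj[of g "c v"] range[of v] v 2 p_less[of g] assms
        by auto
      have "h = r g"
      proof (rule ccontr)
        assume "h \<noteq> r g"
        with h copy 2 have "c (Inr (g, h)) = c (Inr (g, r g))" by simp
        with c h rg \<open>h \<noteq> r g\<close> 2 show False
          by (auto simp: proper_coloring_corona_iff dest: inj_onD)
      qed
      with h 2 show ?thesis by simp
    qed
  qed (auto simp: S_def)
  ultimately show ?thesis by blast
qed

section \<open>Lower bounds for determining sets\<close>

lemma determinesD:
  assumes "determines \<Gamma> S c"
  shows "proper_coloring \<Gamma> (max n (m + 1)) c"
    and "\<lbrakk>proper_coloring \<Gamma> (max n (m + 1)) c'; \<And>v. v \<in> S \<Longrightarrow> c' v = c v\<rbrakk> \<Longrightarrow> c' = c"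
  using assms unfolding determines_def chromatic_number_corona by blast+

lemma card_subset_corona:
  assumes "S \<subseteq> verts \<Gamma>"
  shows "card S = card {g \<in> V. Inl g \<in> S} + (\<Sum>g\<in>V. card {h \<in> W. Inr (g, h) \<in> S})"
proof -
  have "S = Inl ` {g \<in> V. Inl g \<in> S} \<union> Inr ` (SIGMA g:V. {h \<in> W. Inr (g, h) \<in> S})" (is "_ = ?A \<union> ?B")
    using assms by (auto simp: verts_corona)
  moreover have "card (?A \<union> ?B) = card ?A + card ?B"
    by (rule card_Un_disjoint) auto
  ultimately have "card S = card ?A + card ?B" by simp
  then show ?thesis
    by (simp add: card_image)
qed

text \<open>First, \<open>S\<close> contains all copies: a free copy vertex could take a color
  missing from its copy and center. Then more than \<open>m + 1\<close> free centers could switch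
  among their own colors, so at most \<open>m + 1\<close> vertices lie outside
  \<open>S\<close>.\<close>

lemma card_determines_small:
  assumes "m + 1 < n" and det: "determines \<Gamma> S c"
  shows "n * m + n - m - 1 \<le> card S"
proof -
  have sub: "S \<subseteq> verts \<Gamma>" using det by (simp add: determines_def)
  have c: "proper_coloring \<Gamma> n c" using determinesD(1)[OF det] assms(1) by (simp add: max_def)
  have unique: "c' = c" if "proper_coloring \<Gamma> n c'" "\<And>v. v \<in> S \<Longrightarrow> c' v = c v" for c'
    using determinesD(2)[OF det] that assms(1) by (simp add: max_def)
  \<comment> \<open>Colors on the clique formed by \<open>g\<close> and its copy. They number at
    most \<open>m + 1 < n\<close>, so a color of the palette is missing.\<close>
  define used where "used g = insert (c (Inl g)) ((\<lambda>h. c (Inr (g, h))) ` W)" for g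
  have used: "finite (used g)" "card (used g) \<le> m + 1" for g
    unfolding used_def using card_image_le[OF finite_W, of "\<lambda>h. c (Inr (g, h))"]
    by (auto simp: card_insert_if card_W)
  have copies: "Inr (g, h) \<in> S" if gh: "g \<in> V" "h \<in> W" for g h
  proof (rule ccontr)
    assume nS: "Inr (g, h) \<notin> S"
    have "\<not> {1..n} \<subseteq> used g"
    proof
      assume "{1..n} \<subseteq> used g"
      then have "n \<le> card (used g)" using card_mono[OF used(1)[of g], of "{1..n}"] by simp
      with used(2)[of g] assms(1) show False by simp
    qed
    then obtain x where x: "x \<in> {1..n}" "x \<notin> used g" by blast
    have "proper_coloring \<Gamma> n (c(Inr (g, h) := x))"
      unfolding proper_coloring_corona_iff
    proof (intro conjI ballI)
      show "c(Inr (g, h) := x) \<in> verts \<Gamma> \<rightarrow>\<^sub>E {1..n}"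
        using c gh x(1) by (auto simp: proper_coloring_def verts_corona PiE_iff extensional_def)
      show "inj_on (\<lambda>g'. (c(Inr (g, h) := x)) (Inl g')) V"
        using c by (simp add: proper_coloring_corona_iff)
      fix g' assume g': "g' \<in> V"
      have "x \<noteq> c (Inr (g, h'))" if "h' \<in> W" for h'
        using x(2) that by (auto simp: used_def)
      moreover have "inj_on (\<lambda>h'. c (Inr (g', h'))) W"
        using c g' by (simp add: proper_coloring_corona_iff)
      ultimately show "inj_on (\<lambda>h'. (c(Inr (g, h) := x)) (Inr (g', h'))) W"
        by (auto simp: inj_on_def)
      fix h' assume "h' \<in> W"
      then have "c (Inr (g', h')) \<noteq> c (Inl g')"
        using c g' by (simp add: proper_coloring_corona_iff)
      moreover have "x \<noteq> c (Inl g)" using x(2) by (simp add: used_def)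
      ultimately show "(c(Inr (g, h) := x)) (Inr (g', h')) \<noteq> (c(Inr (g, h) := x)) (Inl g')"
        by auto
    qed
    then have "c(Inr (g, h) := x) = c"
      by (rule unique) (use nS in auto)
    then have "c (Inr (g, h)) = x" by (metis fun_upd_same)
    with x gh show False by (auto simp: used_def)
  qed
  define A where "A = {g \<in> V. Inl g \<in> S}"
  define U where "U = V - A"
  have finU: "finite U" by (simp add: U_def)
  have inj: "inj_on (\<lambda>g. c (Inl g)) V" using c by (simp add: proper_coloring_corona_iff)
  then have injU: "inj_on (\<lambda>g. c (Inl g)) U" by (rule inj_on_subset) (auto simp: U_def)
  have "card U \<le> m + 1"
  proof (rule ccontr)
    assume "\<not> card U \<le> m + 1"
    then have big: "m + 1 < card ((\<lambda>g. c (Inl g)) ` U)"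
      by (simp add: card_image[OF injU])
    \<comment> \<open>Pigeonhole: the free centers have more colors than this clique can show. The
      resulting \<open>d g\<close> is absent from the copy and differs from the color of
      \<open>g\<close>.\<close>
    have "\<exists>x. x \<in> (\<lambda>g. c (Inl g)) ` U - used g" for g
      using used[of g] big card_mono[of "used g" "(\<lambda>g. c (Inl g)) ` U"]
      by (meson DiffI leD le_less_trans subsetI)
    then obtain d where d: "\<And>g. d g \<in> (\<lambda>g. c (Inl g)) ` U" "\<And>g. d g \<notin> used g"
      by (metis DiffD1 DiffD2)
    have "U \<noteq> {}" using big by auto
    then obtain e where e: "inj_on e U" "\<And>g. g \<in> U \<Longrightarrow> e g \<in> {c (Inl g), d g}"
      and ne: "\<exists>g\<in>U. e g \<noteq> c (Inl g)"
      using ex_other_inj_on[OF finU _ injU, of d] d(2) by (auto simp: used_def)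
    define c' where "c' v = (case v of Inl g \<Rightarrow> if g \<in> U then e g else c v | Inr _ \<Rightarrow> c v)" for v
    have c'_simps: "c' (Inl g) = (if g \<in> U then e g else c (Inl g))" "c' (Inr gh) = c (Inr gh)" for g gh
      by (simp_all add: c'_def)
    \<comment> \<open>Switched centers stay within the colors of the free centers and so cannot
      clash with prescribed ones.\<close>
    have eU: "e g \<in> (\<lambda>g. c (Inl g)) ` U" if "g \<in> U" for g
      using e(2)[OF that] d(1)[of g] that by auto
    have "proper_coloring \<Gamma> n c'"
      unfolding proper_coloring_corona_iff
    proof (intro conjI ballI)
      show "c' \<in> verts \<Gamma> \<rightarrow>\<^sub>E {1..n}"
      proof (rule PiE_I)
        fix v assume v: "v \<in> verts \<Gamma>"
        have range: "c v \<in> {1..n}" if "v \<in> verts \<Gamma>" for v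
          using c that by (auto simp: proper_coloring_def)
        show "c' v \<in> {1..n}"
        proof (cases "\<exists>g\<in>U. v = Inl g")
          case True
          then obtain g g' where "v = Inl g" "g \<in> U" "g' \<in> U" "e g = c (Inl g')"
            using eU by blast
          then show ?thesis
            using range[of "Inl g'"] by (auto simp: c'_simps U_def verts_corona)
        next
          case False
          then have "c' v = c v" by (auto simp: c'_def split: sum.split)
          then show ?thesis using range v by simp
        qed
      next
        fix v assume v: "v \<notin> verts \<Gamma>"
        then have "c' v = c v"
          by (auto simp: c'_def U_def verts_corona split: sum.split)
        then show "c' v = undefined"
          using c v by (auto simp: proper_coloring_def)
      qed
    next
      show "inj_on (\<lambda>g. c' (Inl g)) V"
      proof (rule inj_onI)
        fix x y assume xy: "x \<in> V" "y \<in> V" "c' (Inl x) = c' (Inl y)"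
        have sep: "e u \<noteq> c (Inl v)" if "u \<in> U" "v \<in> V" "v \<notin> U" for u v
          using eU[OF that(1)] that inj by (auto simp: U_def dest: inj_onD)
        show "x = y"
          using xy sep[of x y] sep[of y x] e(1) inj
          by (auto simp: c'_simps dest: inj_onD split: if_splits)
      qed
    next
      fix g assume g: "g \<in> V"
      show "inj_on (\<lambda>h. c' (Inr (g, h))) W"
        using c g by (simp add: c'_simps proper_coloring_corona_iff)
      fix h assume h: "h \<in> W"
      have "d g \<noteq> c (Inr (g, h))" using d(2)[of g] h by (auto simp: used_def)
      moreover have "c (Inr (g, h)) \<noteq> c (Inl g)"
        using c g h by (simp add: proper_coloring_corona_iff)
      ultimately show "c' (Inr (g, h)) \<noteq> c' (Inl g)"
        using e(2)[of g] by (auto simp: c'_simps)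
    qed
    then have "c' = c"
      by (rule unique) (use sub in \<open>auto simp: c'_def U_def A_def split: sum.split\<close>)
    then show False using ne by (metis c'_simps(1))
  qed
  moreover have "card U = n - card A"
    unfolding U_def by (subst card_Diff_subset) (auto simp: A_def card_V)
  moreover have "card S = card A + n * m"
  proof -
    have "{h \<in> W. Inr (g, h) \<in> S} = W" if "g \<in> V" for g
      using copies that by auto
    then show ?thesis
      unfolding card_subset_corona[OF sub] A_def by (simp add: card_V card_W)
  qed
  ultimately show ?thesis by linarith
qed

text \<open>All recolorings here exchange colors already present on a center and its copy. Each copy
  contributes at least \<open>m - 1\<close> prescribed vertices; a prescribed center or a fully
  prescribed copy supplies the extra one.\<close>

lemma card_determines_large:
  assumes det: "determines \<Gamma> S c"
  shows "n * (m - 1) + 1 \<le> card S"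
proof -
  define k where "k = max n (m + 1)"
  have sub: "S \<subseteq> verts \<Gamma>" using det by (simp add: determines_def)
  have c: "proper_coloring \<Gamma> k c" using determinesD(1)[OF det] by (simp add: k_def)
  have unique: "c' = c" if "proper_coloring \<Gamma> k c'" "\<And>v. v \<in> S \<Longrightarrow> c' v = c v" for c'
    using determinesD(2)[OF det] that by (simp add: k_def)
  have injV: "inj_on (\<lambda>g. c (Inl g)) V" using c by (simp add: proper_coloring_corona_iff)
  have injW: "inj_on (\<lambda>h. c (Inr (g, h))) W" if "g \<in> V" for g
    using c that by (simp add: proper_coloring_corona_iff)
  have sep: "c (Inr (g, h)) \<noteq> c (Inl g)" if "g \<in> V" "h \<in> W" for g h
    using c that by (simp add: proper_coloring_corona_iff)
  have range: "c v \<in> {1..k}" if "v \<in> verts \<Gamma>" for v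
    using c that by (auto simp: proper_coloring_def)
  have ext: "c v = undefined" if "v \<notin> verts \<Gamma>" for v
    using c that by (auto simp: proper_coloring_def)
  define T where "T g = {h \<in> W. Inr (g, h) \<in> S}" for g
  have TW: "T g \<subseteq> W" for g by (auto simp: T_def)
  have at_most_one: "h = h'" if "g \<in> V" "h \<in> W - T g" "h' \<in> W - T g" for g h h'
  proof (rule ccontr)
    assume ne: "h \<noteq> h'"
    \<comment> \<open>Two vertices of one copy have the same neighbors apart from each other, so
      their colors can be swapped.\<close>
    define c' where "c' = c(Inr (g, h) := c (Inr (g, h')), Inr (g, h') := c (Inr (g, h)))"
    have "proper_coloring \<Gamma> k c'"
      unfolding proper_coloring_corona_iff
    proof (intro conjI ballI)
      show "c' \<in> verts \<Gamma> \<rightarrow>\<^sub>E {1..k}"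
        using that range ext by (auto simp: c'_def verts_corona PiE_iff extensional_def)
      show "inj_on (\<lambda>g. c' (Inl g)) V"
        using injV by (simp add: c'_def)
      fix x assume x: "x \<in> V"
      show "inj_on (\<lambda>h. c' (Inr (x, h))) W"
        using injW[OF x] that by (auto simp: c'_def inj_on_def)
      fix y assume "y \<in> W"
      with x show "c' (Inr (x, y)) \<noteq> c' (Inl x)"
        using sep that by (auto simp: c'_def)
    qed
    then have "c' = c"
      by (rule unique) (use that in \<open>auto simp: c'_def T_def\<close>)
    then have "c (Inr (g, h)) = c (Inr (g, h'))"
      by (metis c'_def fun_upd_same)
    with injW that ne show False by (auto dest: inj_onD)
  qed
  have card_T: "m - 1 \<le> card (T g)" if "g \<in> V" for g
  proof -
    have "card (W - T g) \<le> 1"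
      using at_most_one[OF that] by (simp add: card_le_Suc0_iff_eq)
    moreover have "card (W - T g) = m - card (T g)"
      using TW[of g] by (subst card_Diff_subset) (auto simp: card_W intro: finite_subset)
    ultimately show ?thesis by linarith
  qed
  have "\<exists>g\<in>V. Inl g \<in> S \<or> T g = W"
  proof (rule ccontr)
    assume "\<not> (\<exists>g\<in>V. Inl g \<in> S \<or> T g = W)"
    then have free: "\<And>g. g \<in> V \<Longrightarrow> Inl g \<notin> S" and "\<forall>g\<in>V. \<exists>h. h \<in> W - T g"
      using TW by blast+
    \<comment> \<open>A free vertex \<open>r g\<close> of each copy, whose color is offered to the
      center \<open>g\<close> as its second color.\<close>
    then obtain r where r: "\<And>g. g \<in> V \<Longrightarrow> r g \<in> W - T g" by metis
    have "c (Inr (g, r g)) \<noteq> c (Inl g)" if "g \<in> V" for g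
      using sep[OF that] r[OF that] by simp
    from ex_other_inj_on[OF finite_V V_nonempty injV this]
    obtain e where e: "inj_on e V" "\<And>g. g \<in> V \<Longrightarrow> e g \<in> {c (Inl g), c (Inr (g, r g))}"
      and ne: "\<exists>g\<in>V. e g \<noteq> c (Inl g)"
      by blast
    \<comment> \<open>Where a center takes the color of \<open>r g\<close>, the vertex
      \<open>r g\<close> takes the old color of the center, so the colors on that clique are merely
      permuted. The \<open>undefined\<close> branch keeps \<open>c'\<close> extensional.\<close>
    define c' where "c' v = (if v \<notin> verts \<Gamma> then undefined else case v of Inl g \<Rightarrow> e g
      | Inr (g, h) \<Rightarrow> if h = r g \<and> e g \<noteq> c (Inl g) then c (Inl g) else c v)" for v
    have c'_simps: "c' (Inl g) = e g"
      "h \<in> W \<Longrightarrow> c' (Inr (g, h)) = (if h = r g \<and> e g \<noteq> c (Inl g) then c (Inl g) else c (Inr (g, h)))"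
      if "g \<in> V" for g h
      using that by (auto simp: c'_def verts_corona)
    have "proper_coloring \<Gamma> k c'"
      unfolding proper_coloring_corona_iff
    proof (intro conjI ballI)
      show "c' \<in> verts \<Gamma> \<rightarrow>\<^sub>E {1..k}"
      proof (rule PiE_I)
        fix v assume "v \<in> verts \<Gamma>"
        then consider g where "g \<in> V" "v = Inl g" | g h where "g \<in> V" "h \<in> W" "v = Inr (g, h)"
          by (auto simp: verts_corona)
        then show "c' v \<in> {1..k}"
        proof cases
          case 1
          then show ?thesis
            using e(2)[of g] r[of g] range[of "Inl g"] range[of "Inr (g, r g)"]
            by (auto simp: c'_simps verts_corona)
        next
          case 2
          then show ?thesis
            using range[of "Inl g"] range[of "Inr (g, h)"] by (auto simp: c'_simps verts_corona)
        qed
      qed (simp add: c'_def)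
      show "inj_on (\<lambda>g. c' (Inl g)) V"
        using e(1) by (simp add: c'_simps inj_on_def)
      fix g assume g: "g \<in> V"
      show "inj_on (\<lambda>h. c' (Inr (g, h))) W"
      proof (rule inj_onI)
        fix x y assume "x \<in> W" "y \<in> W" "c' (Inr (g, x)) = c' (Inr (g, y))"
        then show "x = y"
          using injW[OF g] sep[OF g, of x] sep[OF g, of y] g
          by (auto simp: c'_simps dest: inj_onD split: if_splits)
      qed
      fix h assume h: "h \<in> W"
      show "c' (Inr (g, h)) \<noteq> c' (Inl g)"
        using e(2)[OF g] r[OF g] injW[OF g] sep[OF g] g h
        by (auto simp: c'_simps dest: inj_onD)
    qed
    then have "c' = c"
    proof (rule unique)
      fix v assume v: "v \<in> S"
      then consider g where "g \<in> V" "v = Inl g" | g h where "g \<in> V" "h \<in> W" "v = Inr (g, h)"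
        using sub by (auto simp: verts_corona)
      then show "c' v = c v"
      proof cases
        case 1
        then show ?thesis using free v by blast
      next
        case 2
        then show ?thesis using r[of g] v by (auto simp: c'_simps T_def)
      qed
    qed
    then show False using ne c'_simps(1) by metis
  qed
  then obtain g where g: "g \<in> V" "Inl g \<in> S \<or> T g = W" by blast
  have lower: "n * (m - 1) \<le> (\<Sum>g\<in>V. card (T g))"
    using sum_mono[of V "\<lambda>_. m - 1" "\<lambda>g. card (T g)"] card_T by (simp add: card_V)
  have card_S: "card S = card {g \<in> V. Inl g \<in> S} + (\<Sum>g\<in>V. card (T g))"
    using card_subset_corona[OF sub] by (simp add: T_def)
  show ?thesis
  proof (cases "Inl g \<in> S")
    case True
    with g have "card {g \<in> V. Inl g \<in> S} > 0" by (auto simp: card_gt_0_iff)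
    with card_S lower show ?thesis by linarith
  next
    case False
    \<comment> \<open>Strict because \<open>m \<ge> 1\<close>; for \<open>m = 0\<close> the
      subtraction would truncate.\<close>
    with g m_pos have "m - 1 < card (T g)" by (simp add: card_W)
    then have "(\<Sum>g\<in>V. m - 1) < (\<Sum>g\<in>V. card (T g))"
      using g card_T by (intro sum_strict_mono_ex1) auto
    with card_S show ?thesis by (simp add: card_V)
  qed
qed

lemma sudoku_number_corona:
  "sudoku_number \<Gamma> = (if m + 1 < n then n * m + n - m - 1 else n * (m - 1) + 1)"
proof (cases "m + 1 < n")
  case True
  then obtain S where "determines \<Gamma> S standard" "card S = n * m + n - m - 1"
    using ex_determines_small by blast
  then show ?thesis
    using True card_determines_small[OF True] by (auto intro: sudoku_number_eqI)
next
  case False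
  then obtain S where "determines \<Gamma> S standard" "card S = n * (m - 1) + 1"
    using ex_determines_large by (metis not_less)
  then show ?thesis
    using False card_determines_large by (auto intro: sudoku_number_eqI)
qed

end

theorem theorem2p5:
  fixes G :: "'a pair_pre_digraph" and H :: "'b pair_pre_digraph" and n m :: nat
  assumes "n \<ge> 3" and "m \<ge> 1"
    and "K\<^bsub>n\<^esub> (with_proj G)" and "K\<^bsub>m\<^esub> (with_proj H)"
  shows "sudoku_number (with_proj (corona G H)) =
    (if m \<le> n - 2 then n * m + n - m - 1 else n * (m - 1) + 1)"
proof -
  have card: "card (pverts G) = n" "card (pverts H) = m"
    using assms(3,4) by (simp_all add: complete_digraph_def)
  then have "finite (pverts G)" "finite (pverts H)"
    using assms(1,2) by (auto intro: card_ge_0_finite)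
  then obtain p q where "bij_betw p (pverts G) {..<n}" "bij_betw q (pverts H) {..<m}"
    using card by (metis ex_bij_betw_finite_nat atLeast0LessThan)
  with assms interpret complete_corona G H n m p q
    by (simp add: complete_corona_def)
  \<comment> \<open>The natural-number difference \<open>n - 2\<close> does not truncate, as
    \<open>n \<ge> 3\<close>.\<close>
  have "m + 1 < n \<longleftrightarrow> m \<le> n - 2" using assms(1) by linarith
  then show ?thesis
    using sudoku_number_corona by simp
qed

end
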